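(* Let $(\mathcal G,\mathcal Y_{\mathcal V},\theta)$ be a binary graphical model whose submodular and supermodular pairwise costs are in diagonal and parallel form respectively, with all coefficients non-negative, and let $g:\{0,1\}^{\mathcal V}\times\{0,1\}^{\mathcal V}\to\mathbb R$ be the associated oriented form with doubled variables (all as defined in the context). Let $\mathcal L$ be the local polytope. Then $$\min_{y,z\in\{0,1\}^{\mathcal V}} g(y,z)=\min_{\mu\in\mathcal L}\langle\theta,\mu\rangle .$$ Moreover, a minimizer $\mu'$ of the right-hand side can be constructed from a minimizer $(y,z)$ of the left-hand side as follows: for every $u\in\mathcal V$, $\mu'_u(1)=y_u$ if $y_u=1-z_u$, and $\mu'_u(1)=\tfrac12$ if $y_u\neq 1-z_u$; $\mu'_u(0)=1-\mu'_u(1)$; and for every $uv\in\mathcal E$, $\mu'_{uv}$ is any element of $$\arg\min\{\langle\theta_{uv},\mu_{uv}\rangle:\ \mu_{uv}\in\mathcal L_{uv}(\mu'_u,\mu'_v)\cap\{0,1,\tfrac12\}^{\mathcal Y_{uv}}\}.$$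
   Context: Let $\mathcal G=(\mathcal V,\mathcal E)$ be a finite simple undirected graph; $\mathcal Y_u=\{0,1\}$ for all $u\in\mathcal V$, $\mathcal Y_{uv}=\{0,1\}^2$ for $uv\in\mathcal E$. The cost vector $\theta$ has coordinates $\theta_u(s)$ ($u\in\mathcal V$, $s\in\{0,1\}$) and $\theta_{uv}(s,t)$ ($uv\in\mathcal E$, $s$ the label of $u$, $t$ the label of $v$). A pairwise cost is submodular if $\theta_{uv}(0,0)+\theta_{uv}(1,1)\le\theta_{uv}(0,1)+\theta_{uv}(1,0)$ and supermodular if the opposite inequality holds. Assumed form of costs: $\theta_u(0),\theta_u(1)\ge 0$ for all $u$; each edge $uv\in\mathcal E$ (with a fixed orientation $(u,v)$) is either in diagonal form, $\theta_{uv}(0,1)=c_{u,v}\ge 0$ and the other three entries are $0$ (corresponding to the monomial $c_{u,v}\bar y_uy_v$; this is submodular), or in parallel form, $\theta_{uv}(1,1)=c_{u,v}\ge0$ and the other three entries are $0$ (corresponding to $c_{u,v}y_uy_v$; this is supermodular). For a binary variable, $\bar x=1-x$. The function $g(y,z)$ is the sum of: for each $u\in\mathcal V$, the terms $\tfrac12\theta_u(1)(y_u+\bar z_u)$ and $\tfrac12\theta_u(0)(\bar y_u+z_u)$; for each edge in diagonal form, $\tfrac12c_{u,v}\bar y_uy_v+\tfrac12c_{u,v}z_u\bar z_v$; for each edge in parallel form, $\tfrac12c_{u,v}y_u\bar z_v+\tfrac12c_{u,v}\bar z_uy_v$. $\Delta^{X}$ denotes the probability simplex with coordinates indexed by the finite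 set $X$. The local polytope $\mathcal L$ is the set of vectors $\mu$ (indexed like $\theta$) with $\mu_u\in\Delta^{\mathcal Y_u}$ for $u\in\mathcal V$, $\mu_{uv}\in\Delta^{\mathcal Y_{uv}}$ for $uv\in\mathcal E$, and $\sum_{t}\mu_{uv}(s,t)=\mu_u(s)$, $\sum_s\mu_{uv}(s,t)=\mu_v(t)$ for all $uv\in\mathcal E$ and all labels $s,t$. $\mathcal L_{uv}(\mu_u,\mu_v)$ is the set of $\mu_{uv}\in\Delta^{\mathcal Y_{uv}}$ satisfying these two families of marginalization constraints for the given $\mu_u,\mu_v$. *)

theory Defs
  imports Complex_Main "HOL-Library.FuncSet"
begin

definition simple_graph :: "'v set \<Rightarrow> 'v set set \<Rightarrow> bool" where
  "simple_graph V E \<longleftrightarrow> finite V \<and> (\<forall>e\<in>E. e \<subseteq> V \<and> card e = 2)"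

text \<open>An undirected edge \<open>e = {u, v}\<close> with \<open>u = tail e\<close> and \<open>v = head e\<close> carries the
  fixed orientation \<open>(u, v)\<close>. In a pairwise function on label pairs \<open>(s, t)\<close>, \<open>s\<close> is the label
  of \<open>tail e\<close> and \<open>t\<close> the label of \<open>head e\<close>.\<close>

definition orientation :: "'v set set \<Rightarrow> ('v set \<Rightarrow> 'v) \<Rightarrow> ('v set \<Rightarrow> 'v) \<Rightarrow> bool" where
  "orientation E tail head \<longleftrightarrow> (\<forall>e\<in>E. e = {tail e, head e})"

abbreviation labels :: "nat set" where
  "labels \<equiv> {0, 1}"

abbreviation label_pairs :: "(nat \<times> nat) set" where
  "label_pairs \<equiv> labels \<times> labels"

text \<open>Vectors indexed by unary pairs (node, label) and pairwise pairs (edge, label pair).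
  The first component is the unary part, the second the pairwise part. Coordinates outside
  the graph and the label sets exist for typing reasons only; nothing below depends on them.\<close>

type_synonym pairwise = "nat \<times> nat \<Rightarrow> real"
type_synonym 'v model_vec = "('v \<Rightarrow> nat \<Rightarrow> real) \<times> ('v set \<Rightarrow> pairwise)"

abbreviation unary_part :: "'v model_vec \<Rightarrow> 'v \<Rightarrow> nat \<Rightarrow> real" where
  "unary_part \<equiv> fst"

abbreviation pairwise_part :: "'v model_vec \<Rightarrow> 'v set \<Rightarrow> pairwise" where
  "pairwise_part \<equiv> snd"

definition inner_pairwise :: "pairwise \<Rightarrow> pairwise \<Rightarrow> real" where
  "inner_pairwise p q = (\<Sum>st\<in>label_pairs. p st * q st)"

definition inner_model :: "'v set \<Rightarrow> 'v set set \<Rightarrow> 'v model_vec \<Rightarrow> 'v model_vec \<Rightarrow> real" where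
  "inner_model V E \<theta> \<mu> =
     (\<Sum>u\<in>V. \<Sum>s\<in>labels. unary_part \<theta> u s * unary_part \<mu> u s)
   + (\<Sum>e\<in>E. inner_pairwise (pairwise_part \<theta> e) (pairwise_part \<mu> e))"

definition submodular :: "pairwise \<Rightarrow> bool" where
  "submodular p \<longleftrightarrow> p (0,0) + p (1,1) \<le> p (0,1) + p (1,0)"

definition supermodular :: "pairwise \<Rightarrow> bool" where
  "supermodular p \<longleftrightarrow> p (0,0) + p (1,1) \<ge> p (0,1) + p (1,0)"

text \<open>The coefficient \<open>c\<^sub>u\<^sub>,\<^sub>v\<close> is the only entry that may be nonzero: \<open>p (0,1)\<close> in diagonal form,
  \<open>p (1,1)\<close> in parallel form. Only the zero cost has both forms.\<close>

definition diagonal_form :: "pairwise \<Rightarrow> bool" where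
  "diagonal_form p \<longleftrightarrow> p (0,1) \<ge> 0 \<and> p (0,0) = 0 \<and> p (1,0) = 0 \<and> p (1,1) = 0"

definition parallel_form :: "pairwise \<Rightarrow> bool" where
  "parallel_form p \<longleftrightarrow> p (1,1) \<ge> 0 \<and> p (0,0) = 0 \<and> p (0,1) = 0 \<and> p (1,0) = 0"

lemma diagonal_form_submodular: "diagonal_form p \<Longrightarrow> submodular p"
  by (simp add: diagonal_form_def submodular_def)

lemma parallel_form_supermodular: "parallel_form p \<Longrightarrow> supermodular p"
  by (simp add: parallel_form_def supermodular_def)

definition nonneg_normal_form :: "'v set \<Rightarrow> 'v set set \<Rightarrow> 'v model_vec \<Rightarrow> bool" where
  "nonneg_normal_form V E \<theta> \<longleftrightarrow>
     (\<forall>u\<in>V. \<forall>s\<in>labels. unary_part \<theta> u s \<ge> 0) \<and>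
     (\<forall>e\<in>E. (submodular (pairwise_part \<theta> e) \<and> diagonal_form (pairwise_part \<theta> e)) \<or>
            (supermodular (pairwise_part \<theta> e) \<and> parallel_form (pairwise_part \<theta> e)))"

abbreviation binary_labelings :: "'v set \<Rightarrow> ('v \<Rightarrow> nat) set" where
  "binary_labelings V \<equiv> V \<rightarrow>\<^sub>E labels"

abbreviation bar :: "nat \<Rightarrow> real" where
  "bar x \<equiv> 1 - real x"

text \<open>The function \<open>g\<close>. An edge with zero cost satisfies both forms; it then contributes
  zero to each of the two edge sums.\<close>

definition oriented_form ::
  "'v set \<Rightarrow> 'v set set \<Rightarrow> ('v set \<Rightarrow> 'v) \<Rightarrow> ('v set \<Rightarrow> 'v) \<Rightarrow> 'v model_vec
     \<Rightarrow> ('v \<Rightarrow> nat) \<Rightarrow> ('v \<Rightarrow> nat) \<Rightarrow> real" where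
  "oriented_form V E tail head \<theta> y z =
     (\<Sum>u\<in>V. 1/2 * unary_part \<theta> u 1 * (real (y u) + bar (z u))
           + 1/2 * unary_part \<theta> u 0 * (bar (y u) + real (z u)))
   + (\<Sum>e \<in> {e\<in>E. diagonal_form (pairwise_part \<theta> e)}.
        1/2 * pairwise_part \<theta> e (0,1) * bar (y (tail e)) * real (y (head e))
      + 1/2 * pairwise_part \<theta> e (0,1) * real (z (tail e)) * bar (z (head e)))
   + (\<Sum>e \<in> {e\<in>E. parallel_form (pairwise_part \<theta> e)}.
        1/2 * pairwise_part \<theta> e (1,1) * real (y (tail e)) * bar (z (head e))
      + 1/2 * pairwise_part \<theta> e (1,1) * bar (z (tail e)) * real (y (head e)))"

definition prob_simplex :: "'a set \<Rightarrow> ('a \<Rightarrow> real) set" where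
  "prob_simplex X = {p. (\<forall>x\<in>X. p x \<ge> 0) \<and> (\<Sum>x\<in>X. p x) = 1}"

definition edge_polytope :: "(nat \<Rightarrow> real) \<Rightarrow> (nat \<Rightarrow> real) \<Rightarrow> pairwise set" where
  "edge_polytope a b = {p \<in> prob_simplex label_pairs.
     (\<forall>s\<in>labels. (\<Sum>t\<in>labels. p (s,t)) = a s) \<and>
     (\<forall>t\<in>labels. (\<Sum>s\<in>labels. p (s,t)) = b t)}"

definition local_polytope ::
  "'v set \<Rightarrow> 'v set set \<Rightarrow> ('v set \<Rightarrow> 'v) \<Rightarrow> ('v set \<Rightarrow> 'v) \<Rightarrow> 'v model_vec set" where
  "local_polytope V E tail head = {\<mu>.
     (\<forall>u\<in>V. unary_part \<mu> u \<in> prob_simplex labels) \<and>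
     (\<forall>e\<in>E. pairwise_part \<mu> e
              \<in> edge_polytope (unary_part \<mu> (tail e)) (unary_part \<mu> (head e)))}"

definition half_integral :: "pairwise set" where
  "half_integral = {p. \<forall>st\<in>label_pairs. p st \<in> {0, 1, 1/2}}"

definition rounded_solution ::
  "'v set \<Rightarrow> 'v set set \<Rightarrow> ('v set \<Rightarrow> 'v) \<Rightarrow> ('v set \<Rightarrow> 'v) \<Rightarrow> 'v model_vec
     \<Rightarrow> ('v \<Rightarrow> nat) \<Rightarrow> ('v \<Rightarrow> nat) \<Rightarrow> 'v model_vec \<Rightarrow> bool" where
  "rounded_solution V E tail head \<theta> y z \<mu> \<longleftrightarrow>
     (\<forall>u\<in>V. unary_part \<mu> u 1 = (if real (y u) = bar (z u) then real (y u) else 1/2) \<and>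
            unary_part \<mu> u 0 = 1 - unary_part \<mu> u 1) \<and>
     (\<forall>e\<in>E. is_arg_min (inner_pairwise (pairwise_part \<theta> e))
        (\<lambda>p. p \<in> edge_polytope (unary_part \<mu> (tail e)) (unary_part \<mu> (head e)) \<inter> half_integral)
        (pairwise_part \<mu> e))"

definition minimizes_oriented_form ::
  "'v set \<Rightarrow> 'v set set \<Rightarrow> ('v set \<Rightarrow> 'v) \<Rightarrow> ('v set \<Rightarrow> 'v) \<Rightarrow> 'v model_vec
     \<Rightarrow> ('v \<Rightarrow> nat) \<Rightarrow> ('v \<Rightarrow> nat) \<Rightarrow> bool" where
  "minimizes_oriented_form V E tail head \<theta> y z \<longleftrightarrow>
     is_arg_min (\<lambda>(y, z). oriented_form V E tail head \<theta> y z)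
       (\<lambda>(y, z). y \<in> binary_labelings V \<and> z \<in> binary_labelings V) (y, z)"

definition minimizes_local_polytope ::
  "'v set \<Rightarrow> 'v set set \<Rightarrow> ('v set \<Rightarrow> 'v) \<Rightarrow> ('v set \<Rightarrow> 'v) \<Rightarrow> 'v model_vec
     \<Rightarrow> 'v model_vec \<Rightarrow> bool" where
  "minimizes_local_polytope V E tail head \<theta> \<mu> \<longleftrightarrow>
     is_arg_min (inner_model V E \<theta>) (\<lambda>\<mu>. \<mu> \<in> local_polytope V E tail head) \<mu>"

end

(* Only the unary masses a u = mu_u(1) matter: the cheapest completion on an edge (u, v) costs
   c * max 0 (a v - a u) in diagonal and c * max 0 (a u + a v - 1) in parallel form. For a
   threshold t in [0, 1], let y_u = [t <= a u] and z_u = [t <= 1 - a u]. Integrating g(y, z)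
   over t yields exactly the relaxation cost of a, so min g is at most the minimum of the
   relaxation. Conversely, the masses a u = (y_u + 1 - z_u) / 2 of the rounded solution have
   relaxation cost at most g(y, z), because the edge costs are convex. *)
theory Submission
  imports Defs "HOL-Analysis.Henstock_Kurzweil_Integration"
begin

text \<open>The two maxima are the least values that \<open>p (0,1)\<close> and
  \<open>p (1,1)\<close> can take when label 1 has masses \<open>a\<close> and \<open>b\<close> at
  the two ends. In either normal form at most one of the two coefficients is nonzero, so adding both
  terms covers both forms without a case distinction.\<close>

definition edge_cost :: "pairwise \<Rightarrow> real \<Rightarrow> real \<Rightarrow> real" where
  "edge_cost p a b = p (0,1) * max 0 (b - a) + p (1,1) * max 0 (a + b - 1)"

text \<open>This is the relaxation with the pairwise coordinates minimized out: a function of the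
  masses of label 1 alone, hence comparable with labelings on both sides of the argument.\<close>

definition relaxed_cost ::
  "'v set \<Rightarrow> 'v set set \<Rightarrow> ('v set \<Rightarrow> 'v) \<Rightarrow> ('v set \<Rightarrow> 'v) \<Rightarrow> 'v model_vec \<Rightarrow> ('v \<Rightarrow> real) \<Rightarrow> real"
  where
  "relaxed_cost V E tail head \<theta> a =
     (\<Sum>u\<in>V. unary_part \<theta> u 1 * a u + unary_part \<theta> u 0 * (1 - a u))
   + (\<Sum>e\<in>E. edge_cost (pairwise_part \<theta> e) (a (tail e)) (a (head e)))"

section \<open>Optimal completions on a single edge\<close>

lemma inner_pairwise_expand:
  "inner_pairwise p q = p (0,0) * q (0,0) + p (0,1) * q (0,1) + p (1,0) * q (1,0) + p (1,1) * q (1,1)"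
proof -
  have "label_pairs = {(0,0), (0,1), (1,0), (1,1)}"
    by auto
  then show ?thesis
    by (simp add: inner_pairwise_def)
qed

lemma mem_edge_polytope_iff:
  "p \<in> edge_polytope a b \<longleftrightarrow>
     p (0,0) \<ge> 0 \<and> p (0,1) \<ge> 0 \<and> p (1,0) \<ge> 0 \<and> p (1,1) \<ge> 0 \<and>
     p (0,0) + p (0,1) + p (1,0) + p (1,1) = 1 \<and>
     p (0,0) + p (0,1) = a 0 \<and> p (1,0) + p (1,1) = a 1 \<and>
     p (0,0) + p (1,0) = b 0 \<and> p (0,1) + p (1,1) = b 1"
proof -
  have "label_pairs = {(0,0), (0,1), (1,0), (1,1)}"
    by auto
  then show ?thesis
    by (auto simp: edge_polytope_def prob_simplex_def)
qed

lemma mem_half_integral_iff: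
  "p \<in> half_integral \<longleftrightarrow> p (0,0) \<in> {0, 1, 1/2} \<and> p (0,1) \<in> {0, 1, 1/2} \<and>
     p (1,0) \<in> {0, 1, 1/2} \<and> p (1,1) \<in> {0, 1, 1/2}"
  by (auto simp: half_integral_def)

lemma nonneg_normal_form_edge:
  assumes "nonneg_normal_form V E \<theta>" "e \<in> E"
  shows "diagonal_form (pairwise_part \<theta> e) \<or> parallel_form (pairwise_part \<theta> e)"
  using assms by (auto simp: nonneg_normal_form_def)

text \<open>Combining the marginal equations gives \<open>b 1 - a 1 = p (0,1) - p (1,0)\<close> and
  \<open>a 1 + b 1 - 1 = p (1,1) - p (0,0)\<close>; nonnegativity of the subtracted entries yields
  both bounds.\<close>

lemma edge_cost_le_inner_pairwise:
  assumes "diagonal_form c \<or> parallel_form c" "p \<in> edge_polytope a b"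
  shows "edge_cost c (a 1) (b 1) \<le> inner_pairwise c p"
proof -
  have "max 0 (b 1 - a 1) \<le> p (0,1)" "max 0 (a 1 + b 1 - 1) \<le> p (1,1)"
    using assms(2) by (auto simp: mem_edge_polytope_iff)
  moreover have "0 \<le> c (0,1)" "0 \<le> c (1,1)" "c (0,0) = 0" "c (1,0) = 0"
    using assms(1) by (auto simp: diagonal_form_def parallel_form_def)
  ultimately show ?thesis
    by (simp only: edge_cost_def inner_pairwise_expand) (simp add: add_mono mult_left_mono)
qed

lemma half_integral_edge_solution:
  assumes form: "diagonal_form c \<or> parallel_form c"
    and a: "a 1 \<in> {0, 1, 1/2}" "a 0 = 1 - a 1"
    and b: "b 1 \<in> {0, 1, 1/2}" "b 0 = 1 - b 1"
  obtains p where "p \<in> edge_polytope a b \<inter> half_integral"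
    "inner_pairwise c p = edge_cost c (a 1) (b 1)"
proof -
  \<comment> \<open>With fixed marginals, \<open>w = p (1,1)\<close> determines the whole table and
    ranges between \<open>max 0 (a 1 + b 1 - 1)\<close> and \<open>min (a 1) (b 1)\<close>. The
    diagonal cost charges \<open>b 1 - w\<close> and wants the upper end, the parallel cost charges
    \<open>w\<close> and wants the lower one. Half-integral masses make both ends
    half-integral.\<close>
  define w where "w = (if diagonal_form c then min (a 1) (b 1) else max 0 (a 1 + b 1 - 1))"
  define p :: pairwise where
    "p = (\<lambda>(s, t). if s = 0 then (if t = 0 then 1 - a 1 - b 1 + w else b 1 - w)
                  else (if t = 0 then a 1 - w else w))"
  have p: "p (0,0) = 1 - a 1 - b 1 + w" "p (0,1) = b 1 - w" "p (1,0) = a 1 - w" "p (1,1) = w"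
    by (simp_all add: p_def)
  show thesis
  proof
    show "p \<in> edge_polytope a b \<inter> half_integral"
      unfolding Int_iff mem_edge_polytope_iff mem_half_integral_iff p w_def
      using a b by auto
    show "inner_pairwise c p = edge_cost c (a 1) (b 1)"
      using form unfolding inner_pairwise_expand edge_cost_def p w_def
      by (auto simp: diagonal_form_def parallel_form_def min_def max_def)
  qed
qed

text \<open>The lower bound holds on the entire edge polytope and is attained at a half-integral
  point. Restricting to such points therefore loses nothing, and the arg min condition turns into an
  equation for the cost.\<close>

lemma is_arg_min_half_integral_edge:
  assumes "diagonal_form c \<or> parallel_form c"
    and "a 1 \<in> {0, 1, 1/2}" "a 0 = 1 - a 1"
    and "b 1 \<in> {0, 1, 1/2}" "b 0 = 1 - b 1"
  shows "is_arg_min (inner_pairwise c) (\<lambda>p. p \<in> edge_polytope a b \<inter> half_integral) p \<longleftrightarrow>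
         p \<in> edge_polytope a b \<inter> half_integral \<and> inner_pairwise c p = edge_cost c (a 1) (b 1)"
proof -
  obtain q where "q \<in> edge_polytope a b \<inter> half_integral"
    "inner_pairwise c q = edge_cost c (a 1) (b 1)"
    using half_integral_edge_solution[OF assms] .
  then show ?thesis
    using edge_cost_le_inner_pairwise[OF assms(1)]
    unfolding is_arg_min_linorder by (metis IntD1 order_antisym)
qed

section \<open>Edgewise form of the relaxation and of \<open>g\<close>\<close>

lemma inner_model_local_polytope:
  assumes "\<mu> \<in> local_polytope V E tail head"
  shows "inner_model V E \<theta> \<mu> =
      (\<Sum>u\<in>V. unary_part \<theta> u 1 * unary_part \<mu> u 1 + unary_part \<theta> u 0 * (1 - unary_part \<mu> u 1))
    + (\<Sum>e\<in>E. inner_pairwise (pairwise_part \<theta> e) (pairwise_part \<mu> e))"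
proof -
  have "unary_part \<mu> u 0 = 1 - unary_part \<mu> u 1" if "u \<in> V" for u
  proof -
    have "unary_part \<mu> u \<in> prob_simplex labels"
      using assms that by (simp add: local_polytope_def)
    then show ?thesis
      by (simp add: prob_simplex_def)
  qed
  then show ?thesis
    by (simp add: inner_model_def add.commute)
qed

lemma relaxed_cost_le_inner_model:
  assumes "nonneg_normal_form V E \<theta>" "\<mu> \<in> local_polytope V E tail head"
  shows "relaxed_cost V E tail head \<theta> (\<lambda>u. unary_part \<mu> u 1) \<le> inner_model V E \<theta> \<mu>"
  unfolding relaxed_cost_def inner_model_local_polytope[OF assms(2)]
proof (intro add_left_mono sum_mono)
  fix e assume "e \<in> E"
  then show "edge_cost (pairwise_part \<theta> e) (unary_part \<mu> (tail e) 1) (unary_part \<mu> (head e) 1)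
      \<le> inner_pairwise (pairwise_part \<theta> e) (pairwise_part \<mu> e)"
    using assms(2)
    by (intro edge_cost_le_inner_pairwise nonneg_normal_form_edge[OF assms(1)])
      (simp_all add: local_polytope_def)
qed

text \<open>The two filtered sums merge because each form makes the coefficient of the other vanish;
  an edge with both forms has cost zero. In every product the barred factor is put first, the shape
  integrated in \<open>has_integral_threshold_diff\<close>.\<close>

lemma oriented_form_edge_sum:
  assumes "finite E" "nonneg_normal_form V E \<theta>"
  shows "oriented_form V E tail head \<theta> y z =
      (\<Sum>u\<in>V. 1/2 * unary_part \<theta> u 1 * (real (y u) + bar (z u))
           + 1/2 * unary_part \<theta> u 0 * (bar (y u) + real (z u)))
    + (\<Sum>e\<in>E. pairwise_part \<theta> e (0,1) / 2 *
          (bar (y (tail e)) * real (y (head e)) + bar (z (head e)) * real (z (tail e)))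
        + pairwise_part \<theta> e (1,1) / 2 *
          (bar (z (head e)) * real (y (tail e)) + bar (z (tail e)) * real (y (head e))))"
  unfolding oriented_form_def sum.inter_filter[OF assms(1)] add.assoc sum.distrib[symmetric]
proof (rule arg_cong2[where f = "(+)", OF refl], rule sum.cong[OF refl])
  fix e assume "e \<in> E"
  from nonneg_normal_form_edge[OF assms(2) this] show
    "(if diagonal_form (pairwise_part \<theta> e)
        then 1/2 * pairwise_part \<theta> e (0,1) * bar (y (tail e)) * real (y (head e))
           + 1/2 * pairwise_part \<theta> e (0,1) * real (z (tail e)) * bar (z (head e)) else 0)
   + (if parallel_form (pairwise_part \<theta> e)
        then 1/2 * pairwise_part \<theta> e (1,1) * real (y (tail e)) * bar (z (head e))
           + 1/2 * pairwise_part \<theta> e (1,1) * bar (z (tail e)) * real (y (head e)) else 0)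
   = pairwise_part \<theta> e (0,1) / 2 *
          (bar (y (tail e)) * real (y (head e)) + bar (z (head e)) * real (z (tail e)))
        + pairwise_part \<theta> e (1,1) / 2 *
          (bar (z (head e)) * real (y (tail e)) + bar (z (tail e)) * real (y (head e)))"
    by (auto simp: diagonal_form_def parallel_form_def field_simps)
qed

section \<open>Threshold labelings and the lower bound\<close>

lemma has_integral_threshold:
  fixes a :: real
  assumes "0 \<le> a" "a \<le> 1"
  shows "((\<lambda>t. of_bool (t \<le> a) :: real) has_integral a) {0..1}"
proof -
  have "((\<lambda>_. 1 :: real) has_integral a) {0..a}"
    using has_integral_const_real[of "1::real" 0 a] assms by simp
  then have "((\<lambda>t. if t \<in> {0..a} then 1 else 0 :: real) has_integral a) {0..1}"
    using assms by (subst has_integral_restrict) auto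
  then show ?thesis
    by (rule has_integral_eq[rotated]) auto
qed

text \<open>The integrand is the indicator of \<open>a < t \<le> b\<close>. As a difference of the
  thresholds at \<open>b\<close> and \<open>min a b\<close> it becomes linear in threshold
  functions.\<close>

lemma has_integral_threshold_diff:
  fixes a b :: real
  assumes "0 \<le> a" "a \<le> 1" "0 \<le> b" "b \<le> 1"
  shows "((\<lambda>t. (1 - of_bool (t \<le> a)) * of_bool (t \<le> b) :: real) has_integral max 0 (b - a)) {0..1}"
proof -
  have "((\<lambda>t. of_bool (t \<le> b) - of_bool (t \<le> min a b) :: real) has_integral b - min a b) {0..1}"
    using assms by (intro has_integral_diff has_integral_threshold) auto
  moreover have "b - min a b = max 0 (b - a)"
    by auto
  ultimately show ?thesis
    by (auto elim!: has_integral_eq[rotated])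
qed

text \<open>Each edge term of \<open>g\<close> is a barred threshold times a plain one, so its
  integral is the length of an interval. Diagonal terms compare thresholds of the same family, at
  \<open>a\<close> or at \<open>1 - a\<close>, and give \<open>max 0 (a v - a u)\<close>; parallel
  terms mix the families and give \<open>max 0 (a u + a v - 1)\<close>. The two halves of an edge
  term have equal integrals, which absorbs the factor 1/2.\<close>

lemma oriented_form_threshold_has_integral:
  assumes graph: "simple_graph V E" and orient: "orientation E tail head"
    and normal: "nonneg_normal_form V E \<theta>"
    and a: "\<And>u. u \<in> V \<Longrightarrow> 0 \<le> a u \<and> a u \<le> 1"
  shows "((\<lambda>t. oriented_form V E tail head \<theta>
            (\<lambda>u\<in>V. of_bool (t \<le> a u)) (\<lambda>u\<in>V. of_bool (t \<le> 1 - a u)))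
          has_integral relaxed_cost V E tail head \<theta> a) {0..1}"
proof -
  have fin: "finite V" "finite E"
    using graph finite_subset[of E "Pow V"] by (auto simp: simple_graph_def)
  have ends: "tail e \<in> V" "head e \<in> V" if "e \<in> E" for e
    using that graph orient unfolding simple_graph_def orientation_def by blast+
  have I: "((\<lambda>t. of_bool (t \<le> a u) :: real) has_integral a u) {0..1}"
    "((\<lambda>t. of_bool (t \<le> 1 - a u) :: real) has_integral 1 - a u) {0..1}"
    "((\<lambda>t. 1 - of_bool (t \<le> a u) :: real) has_integral 1 - a u) {0..1}"
    "((\<lambda>t. 1 - of_bool (t \<le> 1 - a u) :: real) has_integral 1 - (1 - a u)) {0..1}"
    if "u \<in> V" for u
    using a[OF that] has_integral_const_real[of "1::real" 0 1]
    by (intro has_integral_threshold has_integral_diff; simp)+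
  \<comment> \<open>Integrand and value are spelled out exactly as the integration rules produce
    them, including terms such as \<open>1 - (1 - a u)\<close>; the value is simplified to
    \<open>relaxed_cost\<close> afterwards.\<close>
  have "((\<lambda>t.
      (\<Sum>u\<in>V. 1/2 * unary_part \<theta> u 1 * (of_bool (t \<le> a u) + (1 - of_bool (t \<le> 1 - a u)))
           + 1/2 * unary_part \<theta> u 0 * ((1 - of_bool (t \<le> a u)) + of_bool (t \<le> 1 - a u)))
    + (\<Sum>e\<in>E. pairwise_part \<theta> e (0,1) / 2 *
          ((1 - of_bool (t \<le> a (tail e))) * of_bool (t \<le> a (head e))
         + (1 - of_bool (t \<le> 1 - a (head e))) * of_bool (t \<le> 1 - a (tail e)))
        + pairwise_part \<theta> e (1,1) / 2 *
          ((1 - of_bool (t \<le> 1 - a (head e))) * of_bool (t \<le> a (tail e))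
         + (1 - of_bool (t \<le> 1 - a (tail e))) * of_bool (t \<le> a (head e)))))
    has_integral
      (\<Sum>u\<in>V. 1/2 * unary_part \<theta> u 1 * (a u + (1 - (1 - a u)))
           + 1/2 * unary_part \<theta> u 0 * ((1 - a u) + (1 - a u)))
    + (\<Sum>e\<in>E. pairwise_part \<theta> e (0,1) / 2 *
          (max 0 (a (head e) - a (tail e)) + max 0 ((1 - a (tail e)) - (1 - a (head e))))
        + pairwise_part \<theta> e (1,1) / 2 *
          (max 0 (a (tail e) - (1 - a (head e))) + max 0 (a (head e) - (1 - a (tail e))))))
    {0..1}"
    using a ends
    by (intro has_integral_add has_integral_sum has_integral_mult_right
        has_integral_threshold_diff I fin) auto
  moreover have "(\<Sum>u\<in>V. 1/2 * unary_part \<theta> u 1 * (a u + (1 - (1 - a u)))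
           + 1/2 * unary_part \<theta> u 0 * ((1 - a u) + (1 - a u)))
    + (\<Sum>e\<in>E. pairwise_part \<theta> e (0,1) / 2 *
          (max 0 (a (head e) - a (tail e)) + max 0 ((1 - a (tail e)) - (1 - a (head e))))
        + pairwise_part \<theta> e (1,1) / 2 *
          (max 0 (a (tail e) - (1 - a (head e))) + max 0 (a (head e) - (1 - a (tail e)))))
    = relaxed_cost V E tail head \<theta> a"
    unfolding relaxed_cost_def edge_cost_def
    by (intro arg_cong2[where f = "(+)"] sum.cong refl) (auto simp: max_def field_simps)
  ultimately show ?thesis
    unfolding oriented_form_edge_sum[OF fin(2) normal]
    \<comment> \<open>The labelings are restricted to \<open>V\<close>, so they can be evaluated at
      the ends of an edge only once these are known to lie in \<open>V\<close>; the congruence rule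
      supplies the membership in the index sets.\<close>
    using ends by (simp cong: sum.cong)
qed

text \<open>At every \<open>t\<close> the thresholds are binary labelings, so \<open>m\<close>
  bounds the integrand pointwise. The interval has length one, hence \<open>m\<close> also bounds
  the integral.\<close>

lemma oriented_form_lower_bound:
  assumes graph: "simple_graph V E" and orient: "orientation E tail head"
    and normal: "nonneg_normal_form V E \<theta>"
    and bound: "\<And>y z. y \<in> binary_labelings V \<Longrightarrow> z \<in> binary_labelings V \<Longrightarrow>
                  m \<le> oriented_form V E tail head \<theta> y z"
    and \<mu>: "\<mu> \<in> local_polytope V E tail head"
  shows "m \<le> inner_model V E \<theta> \<mu>"
proof -
  define a where "a u = unary_part \<mu> u 1" for u
  have "0 \<le> a u \<and> a u \<le> 1" if "u \<in> V" for u
  proof -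
    have "unary_part \<mu> u \<in> prob_simplex labels"
      using \<mu> that by (simp add: local_polytope_def)
    then show ?thesis
      by (auto simp: prob_simplex_def a_def)
  qed
  from oriented_form_threshold_has_integral[OF graph orient normal this]
  have int: "((\<lambda>t. oriented_form V E tail head \<theta>
            (\<lambda>u\<in>V. of_bool (t \<le> a u)) (\<lambda>u\<in>V. of_bool (t \<le> 1 - a u)))
          has_integral relaxed_cost V E tail head \<theta> a) {0..1}"
    by simp
  have "m \<le> relaxed_cost V E tail head \<theta> a"
  proof (rule has_integral_le[OF _ int])
    show "((\<lambda>_. m) has_integral m) {0..1::real}"
      using has_integral_const_real[of m 0 1] by simp
  qed (auto intro!: bound)
  also have "\<dots> \<le> inner_model V E \<theta> \<mu>"
    unfolding a_def using normal \<mu> by (rule relaxed_cost_le_inner_model)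
  finally show ?thesis .
qed

section \<open>Rounding labelings to half-integral points\<close>

lemma relaxed_cost_le_oriented_form:
  assumes graph: "simple_graph V E" and orient: "orientation E tail head"
    and normal: "nonneg_normal_form V E \<theta>"
    and y: "y \<in> binary_labelings V" and z: "z \<in> binary_labelings V"
    and a: "\<And>u. u \<in> V \<Longrightarrow> a u = (real (y u) + bar (z u)) / 2"
  shows "relaxed_cost V E tail head \<theta> a \<le> oriented_form V E tail head \<theta> y z"
proof -
  have fin: "finite E"
    using graph finite_subset[of E "Pow V"] by (auto simp: simple_graph_def)
  have ends: "tail e \<in> V" "head e \<in> V" if "e \<in> E" for e
    using that graph orient unfolding simple_graph_def orientation_def by blast+
  have binary: "y u = 0 \<or> y u = 1" "z u = 0 \<or> z u = 1" if "u \<in> V" for u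
    using y z that by (auto dest!: PiE_mem)
  show ?thesis
    unfolding oriented_form_edge_sum[OF fin normal] relaxed_cost_def
  proof (rule add_mono; rule sum_mono)
    fix u assume "u \<in> V"
    then show "unary_part \<theta> u 1 * a u + unary_part \<theta> u 0 * (1 - a u)
      \<le> 1/2 * unary_part \<theta> u 1 * (real (y u) + bar (z u))
           + 1/2 * unary_part \<theta> u 0 * (bar (y u) + real (z u))"
      by (simp add: a field_simps)
  next
    fix e assume e: "e \<in> E"
    note e_ends = ends[OF e]
    \<comment> \<open>For binary values, \<open>bar (y u) * y v\<close> is
      \<open>max 0 (y v - y u)\<close>, and the \<open>z\<close> product is the same expression in
      \<open>bar z\<close>. Since \<open>a\<close> is the midpoint of \<open>y\<close> and
      \<open>bar z\<close>, this is convexity of \<open>max 0\<close>, checked here by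
      cases.\<close>
    have "max 0 (a (head e) - a (tail e))
        \<le> (bar (y (tail e)) * real (y (head e)) + bar (z (head e)) * real (z (tail e))) / 2"
      using binary[OF e_ends(1)] binary[OF e_ends(2)] a[OF e_ends(1)] a[OF e_ends(2)]
      by auto
    \<comment> \<open>Likewise, the products are \<open>max 0 (y u + bar (z v) - 1)\<close> and its
      mirror image, whose arguments average to \<open>a u + a v - 1\<close>.\<close>
    moreover have "max 0 (a (tail e) + a (head e) - 1)
        \<le> (bar (z (head e)) * real (y (tail e)) + bar (z (tail e)) * real (y (head e))) / 2"
      using binary[OF e_ends(1)] binary[OF e_ends(2)] a[OF e_ends(1)] a[OF e_ends(2)]
      by auto
    moreover have "0 \<le> pairwise_part \<theta> e (0,1)" "0 \<le> pairwise_part \<theta> e (1,1)"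
      using nonneg_normal_form_edge[OF normal e]
      by (auto simp: diagonal_form_def parallel_form_def)
    ultimately show "edge_cost (pairwise_part \<theta> e) (a (tail e)) (a (head e))
      \<le> pairwise_part \<theta> e (0,1) / 2 *
          (bar (y (tail e)) * real (y (head e)) + bar (z (head e)) * real (z (tail e)))
        + pairwise_part \<theta> e (1,1) / 2 *
          (bar (z (head e)) * real (y (tail e)) + bar (z (tail e)) * real (y (head e)))"
      \<comment> \<open>The factor 1/2 moves from the coefficients to the brackets, where the two
        bounds above apply.\<close>
      unfolding edge_cost_def times_divide_eq_left times_divide_eq_right[symmetric]
      by (intro add_mono mult_left_mono)
  qed
qed

text \<open>If the binary values \<open>y\<close> and \<open>bar z\<close> differ, one is 0 and the
  other 1, so the rounding rule is simply their midpoint. The midpoint form feeds the convexity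
  bound, the half-integrality the edge completions.\<close>

lemma half_integral_rounding:
  fixes y z :: nat
  assumes "y \<in> labels" "z \<in> labels"
  shows "(if real y = bar z then real y else 1/2) = (real y + bar z) / 2"
    and "(if real y = bar z then real y else 1/2) \<in> {0, 1, 1/2}"
  using assms by auto

text \<open>The rule fixes the unary part, after which the edges no longer interact: a minimizer can
  be chosen on each edge separately. This keeps the claim about rounded solutions from being
  vacuous.\<close>

lemma rounded_solution_exists:
  assumes graph: "simple_graph V E" and orient: "orientation E tail head"
    and normal: "nonneg_normal_form V E \<theta>"
    and y: "y \<in> binary_labelings V" and z: "z \<in> binary_labelings V"
  shows "\<exists>\<mu>. rounded_solution V E tail head \<theta> y z \<mu>"
proof -
  define r where "r u = (if real (y u) = bar (z u) then real (y u) else 1/2)" for u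
  define m where "m u s = (if s = 1 then r u else 1 - r u)" for u and s :: nat
  have ends: "tail e \<in> V" "head e \<in> V" if "e \<in> E" for e
    using that graph orient unfolding simple_graph_def orientation_def by blast+
  have m1: "m u 1 \<in> {0, 1, 1/2}" if "u \<in> V" for u
    using half_integral_rounding(2)[OF PiE_mem[OF y that] PiE_mem[OF z that]]
    by (simp add: m_def r_def)
  have m0: "m u 0 = 1 - m u 1" for u
    by (simp add: m_def)
  have "\<exists>p. is_arg_min (inner_pairwise (pairwise_part \<theta> e))
          (\<lambda>p. p \<in> edge_polytope (m (tail e)) (m (head e)) \<inter> half_integral) p"
    if "e \<in> E" for e
    unfolding is_arg_min_half_integral_edge[OF nonneg_normal_form_edge[OF normal that]
        m1[OF ends(1)[OF that]] m0 m1[OF ends(2)[OF that]] m0]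
    using half_integral_edge_solution[OF nonneg_normal_form_edge[OF normal that]
        m1[OF ends(1)[OF that]] m0 m1[OF ends(2)[OF that]] m0]
    by metis
  then obtain P where "\<And>e. e \<in> E \<Longrightarrow> is_arg_min (inner_pairwise (pairwise_part \<theta> e))
          (\<lambda>p. p \<in> edge_polytope (m (tail e)) (m (head e)) \<inter> half_integral) (P e)"
    by metis
  then have "rounded_solution V E tail head \<theta> y z (m, P)"
    by (auto simp: rounded_solution_def m_def r_def)
  then show ?thesis ..
qed

text \<open>On every edge the arg min attains \<open>edge_cost\<close>, so the cost of
  \<open>\<mu>\<close> equals \<open>relaxed_cost\<close> at the midpoints and convexity applies.
  Optimality of \<open>y\<close> and \<open>z\<close> does not enter: rounding never increases the
  cost of any pair.\<close>

lemma rounded_solution_feasible: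
  assumes graph: "simple_graph V E" and orient: "orientation E tail head"
    and normal: "nonneg_normal_form V E \<theta>"
    and y: "y \<in> binary_labelings V" and z: "z \<in> binary_labelings V"
    and \<mu>: "rounded_solution V E tail head \<theta> y z \<mu>"
  shows "\<mu> \<in> local_polytope V E tail head"
    and "inner_model V E \<theta> \<mu> \<le> oriented_form V E tail head \<theta> y z"
proof -
  have ends: "tail e \<in> V" "head e \<in> V" if "e \<in> E" for e
    using that graph orient unfolding simple_graph_def orientation_def by blast+
  have unary: "unary_part \<mu> u 1 \<in> {0, 1, 1/2}" "unary_part \<mu> u 0 = 1 - unary_part \<mu> u 1"
    "unary_part \<mu> u 1 = (real (y u) + bar (z u)) / 2" if "u \<in> V" for u
    using half_integral_rounding[OF PiE_mem[OF y that] PiE_mem[OF z that]] \<mu> that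
    by (simp_all add: rounded_solution_def)
  have edge: "pairwise_part \<mu> e
        \<in> edge_polytope (unary_part \<mu> (tail e)) (unary_part \<mu> (head e)) \<inter> half_integral \<and>
      inner_pairwise (pairwise_part \<theta> e) (pairwise_part \<mu> e)
        = edge_cost (pairwise_part \<theta> e) (unary_part \<mu> (tail e) 1) (unary_part \<mu> (head e) 1)"
    if "e \<in> E" for e
    using \<mu> that is_arg_min_half_integral_edge[OF nonneg_normal_form_edge[OF normal that]
        unary(1,2)[OF ends(1)[OF that]] unary(1,2)[OF ends(2)[OF that]]]
    unfolding rounded_solution_def by blast
  have "unary_part \<mu> u \<in> prob_simplex labels" if "u \<in> V" for u
    using unary(1,2)[OF that] by (auto simp: prob_simplex_def)
  with edge show feasible: "\<mu> \<in> local_polytope V E tail head"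
    by (simp add: local_polytope_def)
  have "inner_model V E \<theta> \<mu> = relaxed_cost V E tail head \<theta> (\<lambda>u. unary_part \<mu> u 1)"
    unfolding inner_model_local_polytope[OF feasible] relaxed_cost_def
    using edge by simp
  also have "\<dots> \<le> oriented_form V E tail head \<theta> y z"
    using graph orient normal y z unary(3) by (rule relaxed_cost_le_oriented_form)
  finally show "inner_model V E \<theta> \<mu> \<le> oriented_form V E tail head \<theta> y z" .
qed

section \<open>Minimizers of both problems\<close>

lemma minimizes_oriented_form_iff:
  "minimizes_oriented_form V E tail head \<theta> y z \<longleftrightarrow>
     y \<in> binary_labelings V \<and> z \<in> binary_labelings V \<and>
     (\<forall>y' \<in> binary_labelings V. \<forall>z' \<in> binary_labelings V.
        oriented_form V E tail head \<theta> y z \<le> oriented_form V E tail head \<theta> y' z')"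
  by (auto simp: minimizes_oriented_form_def is_arg_min_linorder)

lemma minimizes_oriented_form_exists:
  assumes "finite V"
  shows "\<exists>y z. minimizes_oriented_form V E tail head \<theta> y z"
proof -
  let ?S = "binary_labelings V \<times> binary_labelings V"
  have "finite ?S"
    using assms by (intro finite_cartesian_product finite_PiE) auto
  moreover have "?S \<noteq> {}"
    by (simp add: PiE_eq_empty_iff)
  ultimately obtain yz where
    "is_arg_min (\<lambda>(y, z). oriented_form V E tail head \<theta> y z) (\<lambda>yz. yz \<in> ?S) yz"
    using ex_is_arg_min_if_finite by blast
  then have "minimizes_oriented_form V E tail head \<theta> (fst yz) (snd yz)"
    by (auto simp: minimizes_oriented_form_iff is_arg_min_linorder split: prod.splits)
  then show ?thesis
    by blast
qed

text \<open>A sandwich: the cost of \<open>\<mu>\<close> is at most \<open>g\<close> at the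
  minimizing pair, which by thresholding is at most the cost of every feasible point,
  \<open>\<mu>\<close> included.\<close>

lemma rounded_solution_minimizes:
  assumes graph: "simple_graph V E" and orient: "orientation E tail head"
    and normal: "nonneg_normal_form V E \<theta>"
    and yz: "minimizes_oriented_form V E tail head \<theta> y z"
    and \<mu>: "rounded_solution V E tail head \<theta> y z \<mu>"
  shows "minimizes_local_polytope V E tail head \<theta> \<mu>"
    and "oriented_form V E tail head \<theta> y z = inner_model V E \<theta> \<mu>"
proof -
  have y: "y \<in> binary_labelings V" and z: "z \<in> binary_labelings V"
    using yz by (simp_all add: minimizes_oriented_form_iff)
  note feasible = rounded_solution_feasible[OF graph orient normal y z \<mu>]
  have lower: "oriented_form V E tail head \<theta> y z \<le> inner_model V E \<theta> \<nu>"
    if "\<nu> \<in> local_polytope V E tail head" for \<nu>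
    using yz by (intro oriented_form_lower_bound[OF graph orient normal _ that])
      (simp add: minimizes_oriented_form_iff)
  show "minimizes_local_polytope V E tail head \<theta> \<mu>"
    unfolding minimizes_local_polytope_def is_arg_min_linorder
    using feasible lower by (meson order_trans)
  show "oriented_form V E tail head \<theta> y z = inner_model V E \<theta> \<mu>"
    using feasible lower by (simp add: order_antisym)
qed

theorem theorem12p2:
  fixes V :: "'v set" and E :: "'v set set"
    and tail head :: "'v set \<Rightarrow> 'v"
    and \<theta> :: "'v model_vec"
  assumes "simple_graph V E"
    and "orientation E tail head"
    and "nonneg_normal_form V E \<theta>"
  shows "(\<exists>y z \<mu>. minimizes_oriented_form V E tail head \<theta> y z \<and>
            minimizes_local_polytope V E tail head \<theta> \<mu> \<and>
            oriented_form V E tail head \<theta> y z = inner_model V E \<theta> \<mu>) \<and>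
         (\<forall>y z. minimizes_oriented_form V E tail head \<theta> y z \<longrightarrow>
            (\<exists>\<mu>. rounded_solution V E tail head \<theta> y z \<mu>) \<and>
            (\<forall>\<mu>. rounded_solution V E tail head \<theta> y z \<mu> \<longrightarrow>
                 minimizes_local_polytope V E tail head \<theta> \<mu>))"
proof -
  have exists_rounded: "\<exists>\<mu>. rounded_solution V E tail head \<theta> y z \<mu>"
    if "minimizes_oriented_form V E tail head \<theta> y z" for y z
    using that by (intro rounded_solution_exists[OF assms])
      (simp_all add: minimizes_oriented_form_iff)
  have "finite V"
    using assms(1) by (simp add: simple_graph_def)
  \<comment> \<open>That the minimum over the polytope is attained comes from rounding a minimizer
    of the finite problem rather than from compactness.\<close>
  then show ?thesis
    using minimizes_oriented_form_exists[of V E tail head \<theta>] exists_rounded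
      rounded_solution_minimizes[OF assms] by metis
qed

end
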